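(* Let $X=\{X_1,X_2,\dots\}$ be a stationary stochastic process and let $T$ be an invertible transformation. Then the excess entropy of the process $Y:=T(X)=\{T(X_1),T(X_2),\dots\}$ equals the excess entropy of $X$.
   Context: A stationary process is a sequence of random variables whose joint probability distributions do not change when shifted in time. $T$ is a deterministic invertible transformation applied to each variable $X_i$ separately. $H$ denotes Shannon entropy for discrete random variables, $H(X_1,\dots,X_n)=-\sum p(x_1,\dots,x_n)\log p(x_1,\dots,x_n)$ with $p$ the joint probability mass function, and differential entropy for continuous random variables with joint density $f$, $H(X_1,\dots,X_n)=-\int f(x_1,\dots,x_n)\log f(x_1,\dots,x_n)\,dx_1\cdots dx_n$. For a stationary process $X$ put $H_X(n):=H(X_1,\dots,X_n)$ for $n\ge 1$, $H_X(0):=0$, $h_X(n):=H_X(n)-H_X(n-1)$ for $n\ge 1$, and let the entropy rate be $h_\mu(X):=\lim_{n\to\infty}H_X(n)/n$. The excess entropy of $X$ is $E(X):=\sum_{n=1}^{\infty}\big(h_X(n)-h_\mu(X)\big)$, where the value $+\infty$ is allowed. The same definitions apply to $Y$. *)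

theory Defs
  imports "HOL-Probability.Probability"
begin

text \<open>
  A process is a family \<open>X :: nat \<Rightarrow> 'o \<Rightarrow> 'a\<close> of which only the members with index at least 1 are used.
  The measurable space \<open>S\<close> is the state space: \<open>count_space S\<close> with \<open>S\<close> countable for a discrete
  process, a Borel set with its Borel subsets for a continuous one.
\<close>

definition stationary_process :: "'o measure \<Rightarrow> 'a measure \<Rightarrow> (nat \<Rightarrow> 'o \<Rightarrow> 'a) \<Rightarrow> bool" where
  "stationary_process M S X \<longleftrightarrow>
     (\<forall>i\<ge>1. X i \<in> measurable M S) \<and>
     (\<forall>J k. finite J \<and> J \<subseteq> {1..} \<longrightarrow>
        distr M (PiM J (\<lambda>_. S)) (\<lambda>\<omega>. \<lambda>j\<in>J. X (j + k) \<omega>) =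
        distr M (PiM J (\<lambda>_. S)) (\<lambda>\<omega>. \<lambda>j\<in>J. X j \<omega>))"

text \<open>
  An invertible transformation is an isomorphism of the state spaces. Between Borel sets the
  measurability of the inverse is no restriction (Lusin and Souslin); between countable discrete
  spaces every bijection qualifies.
\<close>

definition invertible_transformation :: "'a measure \<Rightarrow> 'b measure \<Rightarrow> ('a \<Rightarrow> 'b) \<Rightarrow> bool" where
  "invertible_transformation S S' T \<longleftrightarrow>
     bij_betw T (space S) (space S') \<and>
     T \<in> measurable S S' \<and>
     the_inv_into (space S) T \<in> measurable S' S"

context information_space
begin

text \<open>
  Below, \<open>R\<close> is the reference measure for a single variable: counting measure for Shannon entropy,
  Lebesgue measure for differential entropy. The two lemmas after the definition recover the usual
  formulas in terms of joint mass functions and joint densities.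
\<close>

definition block_entropy :: "'c measure \<Rightarrow> (nat \<Rightarrow> 'a \<Rightarrow> 'c) \<Rightarrow> nat \<Rightarrow> real" where
  "block_entropy R X n =
     (if n = 0 then 0
      else entropy b (PiM {1..n} (\<lambda>_. R)) (\<lambda>\<omega>. \<lambda>i\<in>{1..n}. X i \<omega>))"

lemma block_entropy_discrete:
  assumes S: "countable S" and X: "\<And>i. i \<ge> 1 \<Longrightarrow> X i \<in> measurable M (count_space S)"
    and n: "n \<ge> 1"
  defines "p \<equiv> \<lambda>x. prob {\<omega> \<in> space M. \<forall>i\<in>{1..n}. X i \<omega> = x i}"
  shows "block_entropy (count_space S) X n =
    - (\<integral>x. p x * log b (p x) \<partial>count_space (PiE {1..n} (\<lambda>_. S)))"
proof -
  let ?Q = "count_space (PiE {1..n} (\<lambda>_. S))" and ?B = "\<lambda>\<omega>. \<lambda>i\<in>{1..n}. X i \<omega>"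
  have Q: "PiM {1..n} (\<lambda>_. count_space S) = ?Q"
    using S by (intro count_space_PiM_finite) auto
  have "?B \<in> measurable M (PiM {1..n} (\<lambda>_. count_space S))"
    using X by (intro measurable_restrict) auto
  then have B: "?B \<in> measurable M ?Q" by (simp only: Q)
  have cQ: "countable (PiE {1..n} (\<lambda>_. S))"
    using S by (intro countable_PiE) auto
  have "distr M ?Q ?B = density ?Q p"
  proof (rule measure_eqI_countable[OF _ _ cQ])
    fix a assume a: "a \<in> PiE {1..n} (\<lambda>_. S)"
    have "?B -` {a} \<inter> space M = {\<omega> \<in> space M. \<forall>i\<in>{1..n}. X i \<omega> = a i}"
      using a by (auto simp: restrict_def PiE_def extensional_def fun_eq_iff)
    then have "emeasure (distr M ?Q ?B) {a} = p a"
      using a B by (simp add: emeasure_distr p_def emeasure_eq_measure)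
    also have "\<dots> = emeasure (density ?Q p) {a}"
      using a by (simp add: emeasure_density nn_integral_indicator_singleton)
    finally show "emeasure (distr M ?Q ?B) {a} = emeasure (density ?Q p) {a}" .
  qed simp_all
  then have "distributed M ?Q ?B p"
    using B by (simp add: distributed_def)
  then have "entropy b ?Q ?B = - (\<integral>x. p x * log b (p x) \<partial>?Q)"
    by (rule entropy_distr) (simp add: p_def)
  then show ?thesis
    using n by (simp only: block_entropy_def Q) simp
qed

lemma block_entropy_continuous:
  assumes "n \<ge> 1"
    and "distributed M (PiM {1..n} (\<lambda>_. lborel)) (\<lambda>\<omega>. \<lambda>i\<in>{1..n}. X i \<omega>) f"
    and "\<And>x. x \<in> space (PiM {1..n} (\<lambda>_. lborel)) \<Longrightarrow> 0 \<le> f x"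
  shows "block_entropy lborel X n = - (\<integral>x. f x * log b (f x) \<partial>PiM {1..n} (\<lambda>_. lborel))"
  using assms entropy_distr[OF assms(2,3)] by (simp add: block_entropy_def)

definition entropy_gain :: "'c measure \<Rightarrow> (nat \<Rightarrow> 'a \<Rightarrow> 'c) \<Rightarrow> nat \<Rightarrow> real" where
  "entropy_gain R X n = block_entropy R X n - block_entropy R X (n - 1)"

text \<open>
  The rate is extended real because the differential entropy rate of a stationary process whose
  joint densities all exist can be \<open>-\<infinity>\<close>; the excess entropy is then \<open>\<infinity>\<close>.
\<close>

definition entropy_rate :: "'c measure \<Rightarrow> (nat \<Rightarrow> 'a \<Rightarrow> 'c) \<Rightarrow> ereal" where
  "entropy_rate R X = lim (\<lambda>n. ereal (block_entropy R X n / real n))"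

definition excess_entropy :: "'c measure \<Rightarrow> (nat \<Rightarrow> 'a \<Rightarrow> 'c) \<Rightarrow> ereal" where
  "excess_entropy R X = (\<Sum>n. ereal (entropy_gain R X (Suc n)) - entropy_rate R X)"

text \<open>
  A continuous process: every block has a joint density and a finite differential entropy, so that
  the differences of block entropies make sense.
\<close>

definition continuous_process :: "(nat \<Rightarrow> 'a \<Rightarrow> 'c::euclidean_space) \<Rightarrow> bool" where
  "continuous_process X \<longleftrightarrow>
     (\<forall>n\<ge>1. \<exists>f. finite_entropy (PiM {1..n} (\<lambda>_. lborel)) (\<lambda>\<omega>. \<lambda>i\<in>{1..n}. X i \<omega>) f)"

end

end

theory Submission
  imports Defs
begin

text \<open>
  For a discrete process the joint mass functions are merely relabelled, so all block entropies
  agree. For a continuous one, write \<open>P\<^sub>n\<close> for the law of a block of length \<open>n\<close>. Then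
  \<open>H(n) = n H(1) - KL(P\<^sub>n, P\<^sub>1 \<otimes> \<dots> \<otimes> P\<^sub>1)\<close>, and the divergence no longer refers to
  Lebesgue measure, so an isomorphism of the state spaces preserves it. No differentiability of \<open>T\<close>
  is needed: \<open>H\<close> changes by \<open>n c\<close> with a constant \<open>c\<close>, the entropy gains and the entropy rate
  change by \<open>c\<close>, and \<open>c\<close> cancels in the excess entropy. That the rate exists as a limit follows from
  subadditivity of \<open>H\<close> (Gibbs' inequality) and Fekete's lemma.
\<close>

section \<open>Fekete's lemma and convergence of averaged block entropies\<close>

lemma superadditive_mult_le:
  fixes a :: "nat \<Rightarrow> real"
  assumes super: "\<And>m n. a m + a n \<le> a (m + n)" and nonneg: "\<And>n. 0 \<le> a n"
  shows "real q * a k \<le> a (q * k)"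
proof (induction q)
  case (Suc q)
  have "real (Suc q) * a k = a k + real q * a k"
    by (simp add: algebra_simps)
  also have "\<dots> \<le> a (k + q * k)"
    using Suc super[of k "q * k"] by simp
  finally show ?case by simp
qed (simp add: nonneg)

lemma tendsto_div_nat_over:
  assumes "0 < k"
  shows "(\<lambda>n. real (n div k) / real n) \<longlonglongrightarrow> 1 / real k"
proof (rule tendsto_sandwich)
  have "(\<lambda>n. 1 / real k - inverse (real n)) \<longlonglongrightarrow> 1 / real k - 0"
    by (intro tendsto_intros lim_inverse_n)
  then show "(\<lambda>n. 1 / real k - inverse (real n)) \<longlonglongrightarrow> 1 / real k" by simp
  show "\<forall>\<^sub>F n in sequentially. 1 / real k - inverse (real n) \<le> real (n div k) / real n"
    using eventually_gt_at_top[of 0]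
  proof eventually_elim
    case (elim n)
    have "real n / real k - 1 \<le> real (n div k)"
      using dividend_less_div_times[OF assms, of n] assms
      by (simp add: field_simps flip: of_nat_mult of_nat_add)
    with elim have "(real n / real k - 1) / real n \<le> real (n div k) / real n"
      by (intro divide_right_mono) auto
    with elim assms show ?case by (simp add: field_simps)
  qed
  show "\<forall>\<^sub>F n in sequentially. real (n div k) / real n \<le> 1 / real k"
    using eventually_gt_at_top[of 0]
  proof eventually_elim
    case (elim n)
    have "real (n div k) / real n \<le> (real n / real k) / real n"
      using of_nat_div_le_of_nat[of n k] by (intro divide_right_mono) auto
    with elim show ?case by simp
  qed
qed simp

text \<open>Split n into \<open>n div k\<close> blocks of length k and a remainder: superadditivity
  and nonnegativity bound \<open>a n\<close> below by \<open>n div k\<close> copies of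
  \<open>a k\<close>, and \<open>(n div k) / n\<close> tends to 1/k. So the quotients eventually
  exceed every number below any \<open>a k / k\<close>, while for n at least 1 each is itself a term
  of the supremum. The supremum may be infinite, hence the extended reals.\<close>

lemma fekete_superadditive:
  fixes a :: "nat \<Rightarrow> real"
  assumes super: "\<And>m n. a m + a n \<le> a (m + n)" and nonneg: "\<And>n. 0 \<le> a n"
  shows "(\<lambda>n. ereal (a n / real n)) \<longlonglongrightarrow> (SUP k\<in>{1..}. ereal (a k / real k))"
proof (rule order_tendstoI)
  fix l assume "l < (SUP k\<in>{1..}. ereal (a k / real k))"
  then obtain k where k: "1 \<le> k" "l < ereal (a k / real k)"
    by (auto simp: less_SUP_iff)
  have "(\<lambda>n. real (n div k) / real n * a k) \<longlonglongrightarrow> 1 / real k * a k"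
    using k by (intro tendsto_intros tendsto_div_nat_over) auto
  then have "(\<lambda>n. ereal (real (n div k) / real n * a k)) \<longlonglongrightarrow> ereal (a k / real k)"
    by simp
  from order_tendstoD(1)[OF this k(2)]
  show "\<forall>\<^sub>F n in sequentially. l < ereal (a n / real n)"
    using eventually_gt_at_top[of 0]
  proof eventually_elim
    case (elim n)
    have "real (n div k) * a k \<le> a (n div k * k)"
      by (rule superadditive_mult_le[OF super nonneg])
    also have "\<dots> \<le> a (n div k * k + n mod k)"
      using super[of "n div k * k" "n mod k"] nonneg[of "n mod k"] by simp
    finally have "real (n div k) / real n * a k \<le> a n / real n"
      using elim by (simp add: divide_right_mono)
    then show ?case
      using elim by (meson ereal_less_eq(3) less_le_trans)
  qed
next
  fix u assume u: "(SUP k\<in>{1..}. ereal (a k / real k)) < u"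
  show "\<forall>\<^sub>F n in sequentially. ereal (a n / real n) < u"
    using eventually_ge_at_top[of 1]
  proof eventually_elim
    case (elim n)
    then have "ereal (a n / real n) \<le> (SUP k\<in>{1..}. ereal (a k / real k))"
      by (intro SUP_upper) auto
    then show ?case using u by simp
  qed
qed

text \<open>Fekete's lemma above needs a nonnegative sequence, and \<open>h\<close> may have either
  sign. The defect \<open>n * h 1 - h n\<close> is nonnegative and superadditive; for block
  entropies it is the total correlation.\<close>

lemma convergent_subadditive_div:
  fixes h :: "nat \<Rightarrow> real"
  assumes sub: "\<And>m n. h (m + n) \<le> h m + h n" and zero: "h 0 = 0"
  shows "convergent (\<lambda>n. ereal (h n / real n))"
proof -
  define a where "a n = real n * h 1 - h n" for n
  have super: "a m + a n \<le> a (m + n)" for m n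
    using sub[of m n] by (simp add: a_def algebra_simps)
  have nonneg: "0 \<le> a n" for n
  proof (induction n)
    case (Suc n)
    \<comment> \<open>\<open>a 1\<close> is zero by construction, so superadditivity gives
      \<open>a n\<close> \<le> \<open>a (Suc n)\<close>.\<close>
    then show ?case using super[of n 1] by (simp add: a_def algebra_simps)
  qed (simp add: a_def zero)
  define L where "L = (SUP k\<in>{1..}. ereal (a k / real k))"
  have "(\<lambda>n. - ereal (a n / real n) + ereal (h 1)) \<longlonglongrightarrow> - L + ereal (h 1)"
    unfolding L_def
    by (intro tendsto_add_left_ereal tendsto_uminus_ereal fekete_superadditive super nonneg) simp_all
  \<comment> \<open>Only for n > 0: at 0 the quotients are 0 by the convention for division, and
    \<open>h 1\<close> need not vanish.\<close>
  moreover have "\<forall>\<^sub>F n in sequentially. - ereal (a n / real n) + ereal (h 1) = ereal (h n / real n)"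
    using eventually_gt_at_top[of 0] by eventually_elim (simp add: a_def field_simps)
  ultimately show ?thesis
    unfolding convergent_def by (blast intro: Lim_transform_eventually)
qed

section \<open>Product measures over sigma-finite factors\<close>

text \<open>A sigma-finite product is determined by rectangles, and pulling a rectangle back along
  the relabelling only renames its sides. With Lebesgue measure as \<open>R\<close> this moves a
  block at indices m+1 to m+n back to 1 to n.\<close>

lemma distr_PiM_reindex_sigma_finite:
  assumes R: "sigma_finite_measure R" and I: "finite I" and t: "inj_on t I"
  shows "distr (PiM (t ` I) (\<lambda>_. R)) (PiM I (\<lambda>_. R)) (\<lambda>x. \<lambda>i\<in>I. x (t i)) = PiM I (\<lambda>_. R)"
proof -
  interpret sigma_finite_measure R by fact
  interpret product_sigma_finite "\<lambda>_. R" ..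
  show ?thesis
  proof (rule PiM_eqI[OF I])
    fix A assume A: "\<And>i. i \<in> I \<Longrightarrow> A i \<in> sets R"
    let ?B = "\<lambda>k. A (the_inv_into I t k)"
    have meas: "(\<lambda>x. \<lambda>i\<in>I. x (t i)) \<in> measurable (PiM (t ` I) (\<lambda>_. R)) (PiM I (\<lambda>_. R))"
      by (intro measurable_restrict measurable_component_singleton) auto
    have sub: "A i \<subseteq> space R" if "i \<in> I" for i
      using A[OF that] by (rule sets.sets_into_space)
    have "(\<lambda>x. \<lambda>i\<in>I. x (t i)) -` Pi\<^sub>E I A \<inter> space (PiM (t ` I) (\<lambda>_. R)) = Pi\<^sub>E (t ` I) ?B"
      using subsetD[OF sub] t by (auto simp: space_PiM PiE_iff the_inv_into_f_f)
    then have "emeasure (distr (PiM (t ` I) (\<lambda>_. R)) (PiM I (\<lambda>_. R)) (\<lambda>x. \<lambda>i\<in>I. x (t i))) (Pi\<^sub>E I A)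
      = emeasure (PiM (t ` I) (\<lambda>_. R)) (Pi\<^sub>E (t ` I) ?B)"
      using A I by (subst emeasure_distr[OF meas]) (auto intro!: sets_PiM_I_finite)
    also have "\<dots> = (\<Prod>k\<in>t ` I. emeasure R (?B k))"
      using A I t by (intro emeasure_PiM) (auto simp: the_inv_into_f_f)
    also have "\<dots> = (\<Prod>i\<in>I. emeasure R (A i))"
      using t by (simp add: prod.reindex the_inv_into_f_f)
    finally show "emeasure (distr (PiM (t ` I) (\<lambda>_. R)) (PiM I (\<lambda>_. R)) (\<lambda>x. \<lambda>i\<in>I. x (t i))) (Pi\<^sub>E I A)
      = (\<Prod>i\<in>I. emeasure R (A i))" .
  qed simp
qed

text \<open>Tonelli for the split of the indices into the first m and the last n, followed by
  relabelling of the second group. It shows later that the product of two block densities has total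
  mass one.\<close>

lemma nn_integral_PiM_concat:
  fixes f g :: "(nat \<Rightarrow> 'c) \<Rightarrow> ennreal"
  assumes R: "sigma_finite_measure R"
    and f[measurable]: "f \<in> borel_measurable (PiM {1..m} (\<lambda>_. R))"
    and g[measurable]: "g \<in> borel_measurable (PiM {1..n} (\<lambda>_. R))"
  shows "(\<integral>\<^sup>+x. f (restrict x {1..m}) * g (\<lambda>j\<in>{1..n}. x (j + m)) \<partial>PiM {1..m+n} (\<lambda>_. R))
    = integral\<^sup>N (PiM {1..m} (\<lambda>_. R)) f * integral\<^sup>N (PiM {1..n} (\<lambda>_. R)) g"
proof -
  interpret sigma_finite_measure R by fact
  interpret product_sigma_finite "\<lambda>_. R" ..
  let ?I = "{1..m}" and ?J = "(\<lambda>j. j + m) ` {1..n}"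
  have J: "?J = {m+1..m+n}" by (auto simp: image_add_atLeastAtMost)
  have IJ: "?I \<inter> ?J = {}" "finite ?I" "finite ?J" and un: "{1..m+n} = ?I \<union> ?J"
    unfolding J by auto
  have r: "(\<lambda>x. restrict x ?I) \<in> measurable (PiM (?I \<union> ?J) (\<lambda>_. R)) (PiM ?I (\<lambda>_. R))"
    by (intro measurable_restrict measurable_component_singleton) auto
  have s: "(\<lambda>x. \<lambda>j\<in>{1..n}. x (j + m)) \<in> measurable (PiM (?I \<union> ?J) (\<lambda>_. R)) (PiM {1..n} (\<lambda>_. R))"
    by (intro measurable_restrict measurable_component_singleton) auto
  have s': "(\<lambda>x. \<lambda>j\<in>{1..n}. x (j + m)) \<in> measurable (PiM ?J (\<lambda>_. R)) (PiM {1..n} (\<lambda>_. R))"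
    by (intro measurable_restrict measurable_component_singleton) auto
  have "(\<integral>\<^sup>+x. f (restrict x ?I) * g (\<lambda>j\<in>{1..n}. x (j + m)) \<partial>PiM {1..m+n} (\<lambda>_. R)) =
    (\<integral>\<^sup>+x. (\<integral>\<^sup>+y. f (restrict (merge ?I ?J (x, y)) ?I) * g (\<lambda>j\<in>{1..n}. merge ?I ?J (x, y) (j + m))
        \<partial>PiM ?J (\<lambda>_. R)) \<partial>PiM ?I (\<lambda>_. R))"
    unfolding un
    by (rule product_nn_integral_fold[OF IJ])
       (intro borel_measurable_times_ennreal measurable_compose[OF r f] measurable_compose[OF s g])
  also have "\<dots> = (\<integral>\<^sup>+x. (\<integral>\<^sup>+y. f x * g (\<lambda>j\<in>{1..n}. y (j + m)) \<partial>PiM ?J (\<lambda>_. R)) \<partial>PiM ?I (\<lambda>_. R))"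
  proof (intro nn_integral_cong)
    fix x y assume x: "x \<in> space (PiM ?I (\<lambda>_. R))"
    have "restrict (merge ?I ?J (x, y)) ?I = x"
      using x by (auto simp: space_PiM restrict_def merge_def PiE_iff extensional_def fun_eq_iff)
    moreover have "(\<lambda>j\<in>{1..n}. merge ?I ?J (x, y) (j + m)) = (\<lambda>j\<in>{1..n}. y (j + m))"
      by (auto simp: restrict_def merge_def fun_eq_iff)
    ultimately show "f (restrict (merge ?I ?J (x, y)) ?I) * g (\<lambda>j\<in>{1..n}. merge ?I ?J (x, y) (j + m))
      = f x * g (\<lambda>j\<in>{1..n}. y (j + m))" by simp
  qed
  also have "\<dots> = integral\<^sup>N (PiM ?I (\<lambda>_. R)) f * (\<integral>\<^sup>+y. g (\<lambda>j\<in>{1..n}. y (j + m)) \<partial>PiM ?J (\<lambda>_. R))"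
    using measurable_compose[OF s' g] f by (simp add: nn_integral_cmult nn_integral_multc)
  also have "(\<integral>\<^sup>+y. g (\<lambda>j\<in>{1..n}. y (j + m)) \<partial>PiM ?J (\<lambda>_. R)) =
      integral\<^sup>N (distr (PiM ?J (\<lambda>_. R)) (PiM {1..n} (\<lambda>_. R)) (\<lambda>x. \<lambda>j\<in>{1..n}. x (j + m))) g"
    by (rule nn_integral_distr[OF s', symmetric]) (use g in simp)
  also have "\<dots> = integral\<^sup>N (PiM {1..n} (\<lambda>_. R)) g"
    by (subst distr_PiM_reindex_sigma_finite[OF R]) (auto intro: inj_onI)
  finally show ?thesis .
qed

section \<open>Divergence under left-invertible maps, and densities\<close>

text \<open>Since \<open>T'\<close> undoes \<open>T\<close>, every measurable set of
  \<open>P\<close> is a preimage under \<open>T\<close>, so the Radon-Nikodym derivative of the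
  images, composed with \<open>T\<close>, is that of the originals. Allowing \<open>P\<close> to be
  sigma-finite covers counting measure, relative to which minus the divergence is Shannon
  entropy.\<close>

lemma KL_divergence_distr:
  assumes P: "sigma_finite_measure P" and Q: "sets Q = sets P"
    and T: "T \<in> measurable P P'" and T': "T' \<in> measurable P' P"
    and inv: "\<And>x. x \<in> space P \<Longrightarrow> T' (T x) = x"
    and ac: "absolutely_continuous (distr P P' T) (distr Q P' T)"
  shows "KL_divergence b (distr P P' T) (distr Q P' T) = KL_divergence b P Q"
proof -
  interpret sigma_finite_measure P by fact
  have TQ: "T \<in> measurable Q P'"
    using T by (simp add: measurable_cong_sets[OF Q refl])
  have spQ: "space Q = space P" by (rule sets_eq_imp_space_eq[OF Q])
  have eqs: "T -` (T' -` A \<inter> space P') \<inter> space P = A" if "A \<in> sets P" for A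
    using inv sets.sets_into_space[OF that] measurable_space[OF T] by auto
  \<comment> \<open>The derivatives agree only \<open>P\<close>-almost everywhere, whereas the
    divergence integrates over \<open>Q\<close>; absolute continuity, pulled back through
    \<open>T\<close>, carries the identity from \<open>P\<close> to \<open>Q\<close>.\<close>
  have "absolutely_continuous P Q"
    unfolding absolutely_continuous_def
  proof
    fix A assume A: "A \<in> null_sets P"
    then have "T' -` A \<inter> space P' \<in> null_sets (distr P P' T)"
      using measurable_sets[OF T'] by (simp only: null_sets_distr_iff[OF T] eqs null_setsD2)
    with ac have "T' -` A \<inter> space P' \<in> null_sets (distr Q P' T)"
      by (auto simp: absolutely_continuous_def)
    with A show "A \<in> null_sets Q"
      by (simp only: null_sets_distr_iff[OF TQ] spQ eqs null_setsD2)
  qed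
  moreover have "AE x in P. RN_deriv (distr P P' T) (distr Q P' T) (T x) = RN_deriv P Q x"
    using inv by (intro RN_deriv_distr[OF T T' _ ac Q]) auto
  ultimately have ae: "AE x in Q. RN_deriv (distr P P' T) (distr Q P' T) (T x) = RN_deriv P Q x"
    using absolutely_continuous_AE Q by blast
  let ?d = "entropy_density b (distr P P' T) (distr Q P' T)"
  have d: "?d \<in> borel_measurable P'"
    using measurable_entropy_density[of b "distr P P' T" "distr Q P' T"] by simp
  have d': "entropy_density b P Q \<in> borel_measurable Q"
    using measurable_entropy_density[of b P Q] by (simp add: measurable_cong_sets[OF Q refl])
  show ?thesis
    unfolding KL_divergence_def integral_distr[OF TQ d]
    by (intro integral_cong_AE measurable_compose[OF TQ d] d')
       (use ae in \<open>auto simp: entropy_density_def\<close>)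
qed

text \<open>The zero set of \<open>f\<close> has mass zero under \<open>density L f\<close>, the law
  of \<open>Z\<close>. This lets logarithms of products and quotients of densities split almost
  surely.\<close>

lemma distributed_AE_pos:
  fixes f :: "'b \<Rightarrow> real"
  assumes "distributed M L Z f" "\<And>x. x \<in> space L \<Longrightarrow> 0 \<le> f x"
  shows "AE \<omega> in M. 0 < f (Z \<omega>)"
proof -
  note [measurable] = distributed_real_measurable[OF assms(2,1)]
  have "AE x in L. 0 < ennreal (f x) \<longrightarrow> 0 < f x"
    by (simp)
  then have "AE x in density L f. 0 < f x"
    using distributed_borel_measurable[OF assms(1)] by (subst AE_density) auto
  then show ?thesis
    unfolding distributed_distr_eq_density[OF assms(1), symmetric]
    using distributed_measurable[OF assms(1)]
    by (subst (asm) AE_distr_iff) auto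
qed

text \<open>Both sides give a rectangle the product of the integrals of \<open>f\<close> over its
  sides. That \<open>density R f\<close> is a probability space makes the factors on the left
  sigma-finite, as uniqueness on rectangles requires.\<close>

lemma PiM_density_power:
  fixes f :: "'c \<Rightarrow> real"
  assumes R: "sigma_finite_measure R" and I: "finite I"
    and f[measurable]: "f \<in> borel_measurable R" and nn: "\<And>x. x \<in> space R \<Longrightarrow> 0 \<le> f x"
    and P: "prob_space (density R f)"
  shows "PiM I (\<lambda>_. density R f) = density (PiM I (\<lambda>_. R)) (\<lambda>x. ennreal (\<Prod>i\<in>I. f (x i)))"
proof -
  interpret R: sigma_finite_measure R by fact
  interpret R: product_sigma_finite "\<lambda>_. R" ..
  interpret P: prob_space "density R f" by fact
  interpret P: product_sigma_finite "\<lambda>_. density R f" ..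
  show ?thesis
  proof (rule P.PiM_eqI[OF I, symmetric])
    show "sets (density (PiM I (\<lambda>_. R)) (\<lambda>x. ennreal (\<Prod>i\<in>I. f (x i)))) = sets (PiM I (\<lambda>_. density R f))"
      by (auto intro!: sets_PiM_cong)
    fix A assume "\<And>i. i \<in> I \<Longrightarrow> A i \<in> sets (density R f)"
    then have A[measurable]: "\<And>i. i \<in> I \<Longrightarrow> A i \<in> sets R" by simp
    have m: "(\<lambda>x. ennreal (\<Prod>i\<in>I. f (x i))) \<in> borel_measurable (PiM I (\<lambda>_. R))"
      by measurable
    have "emeasure (density (PiM I (\<lambda>_. R)) (\<lambda>x. ennreal (\<Prod>i\<in>I. f (x i)))) (Pi\<^sub>E I A) =
      (\<integral>\<^sup>+x. ennreal (\<Prod>i\<in>I. f (x i)) * indicator (Pi\<^sub>E I A) x \<partial>PiM I (\<lambda>_. R))"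
      using A I by (intro emeasure_density m sets_PiM_I_finite) auto
    also have "\<dots> = (\<integral>\<^sup>+x. (\<Prod>i\<in>I. ennreal (f (x i)) * indicator (A i) (x i)) \<partial>PiM I (\<lambda>_. R))"
    proof (intro nn_integral_cong)
      fix x assume x: "x \<in> space (PiM I (\<lambda>_. R))"
      have "ennreal (\<Prod>i\<in>I. f (x i)) = (\<Prod>i\<in>I. ennreal (f (x i)))"
        using x nn by (intro prod_ennreal[symmetric]) (auto simp: space_PiM)
      moreover have "indicator (Pi\<^sub>E I A) x = (\<Prod>i\<in>I. indicator (A i) (x i) :: ennreal)"
        using x I by (auto simp: indicator_def space_PiM PiE_iff)
      ultimately show "ennreal (\<Prod>i\<in>I. f (x i)) * indicator (Pi\<^sub>E I A) x
        = (\<Prod>i\<in>I. ennreal (f (x i)) * indicator (A i) (x i))"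
        by (simp add: prod.distrib)
    qed
    also have "\<dots> = (\<Prod>i\<in>I. \<integral>\<^sup>+x. ennreal (f x) * indicator (A i) x \<partial>R)"
      using I A by (intro R.product_nn_integral_prod) auto
    also have "\<dots> = (\<Prod>i\<in>I. emeasure (density R f) (A i))"
      by (intro prod.cong refl emeasure_density[symmetric]) auto
    finally show "emeasure (density (PiM I (\<lambda>_. R)) (\<lambda>x. ennreal (\<Prod>i\<in>I. f (x i)))) (Pi\<^sub>E I A) =
      (\<Prod>i\<in>I. emeasure (density R f) (A i))" .
  qed
qed

section \<open>Entropy and divergence through densities\<close>

context information_space
begin

text \<open>The divergence of the law of \<open>Z\<close> relative to \<open>density L g\<close> is
  the expectation of log(f/g) along \<open>Z\<close>; splitting the logarithm leaves minus the
  entropy and a cross term, and nonnegativity of the divergence becomes Gibbs' inequality. Two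
  choices of \<open>g\<close> matter later: the product of the marginal densities, and the product
  of the densities of two consecutive blocks.\<close>

lemma distributed_KL_density:
  fixes f g :: "'b \<Rightarrow> real"
  assumes L: "sigma_finite_measure L"
    and f: "distributed M L Z f" "\<And>x. x \<in> space L \<Longrightarrow> 0 \<le> f x"
    and g: "g \<in> borel_measurable L" "\<And>x. x \<in> space L \<Longrightarrow> 0 \<le> g x"
    and pos: "AE \<omega> in M. 0 < g (Z \<omega>)"
    and intf: "integrable M (\<lambda>\<omega>. log b (f (Z \<omega>)))"
    and intg: "integrable M (\<lambda>\<omega>. log b (g (Z \<omega>)))"
  shows absolutely_continuous_density_distr:
      "absolutely_continuous (density L g) (distr M L Z)" (is ?ac)
    and KL_divergence_density_entropy:
      "KL_divergence b (density L g) (distr M L Z) = - entropy b L Z - (\<integral>\<omega>. log b (g (Z \<omega>)) \<partial>M)" (is ?eq)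
    and gibbs_entropy_le:
      "prob_space (density L g) \<Longrightarrow> entropy b L Z \<le> - (\<integral>\<omega>. log b (g (Z \<omega>)) \<partial>M)" (is "_ \<Longrightarrow> ?le")
proof -
  interpret sigma_finite_measure L by fact
  note [measurable] = distributed_real_measurable[OF f(2,1)] g(1)
  have Z[measurable]: "Z \<in> measurable M L" by (rule distributed_measurable[OF f(1)])
  have D: "distr M L Z = density L f" by (rule distributed_distr_eq_density[OF f(1)])
  \<comment> \<open>Read through the law of \<open>Z\<close>, positivity of \<open>g\<close> along
    \<open>Z\<close> says that \<open>f\<close> vanishes almost everywhere on the zero set of
    \<open>g\<close>.\<close>
  have "AE x in density L f. 0 < g x"
    unfolding D[symmetric] using pos by (subst AE_distr_iff) auto
  then have "AE x in L. 0 < ennreal (f x) \<longrightarrow> 0 < g x"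
    by (subst (asm) AE_density) auto
  then have ac: "AE x in L. g x = 0 \<longrightarrow> f x = 0"
    using AE_space
  proof eventually_elim
    case (elim x)
    with f(2)[of x] show ?case by (auto simp: less_le)
  qed
  have nonneg: "AE x in L. 0 \<le> f x" "AE x in L. 0 \<le> g x"
    using f(2) g(2) by auto
  have gm: "(\<lambda>x. ennreal (g x)) \<in> borel_measurable L" and fm: "(\<lambda>x. ennreal (f x)) \<in> borel_measurable L"
    by measurable
  show ?ac
    unfolding D absolutely_continuous_def
  proof
    fix A assume "A \<in> null_sets (density L g)"
    then have A: "A \<in> sets L" "AE x in L. x \<in> A \<longrightarrow> ennreal (g x) = 0"
      by (simp_all add: null_sets_density_iff[OF gm])
    have "AE x in L. x \<in> A \<longrightarrow> ennreal (f x) = 0"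
      using A(2) ac nonneg(2)
      by eventually_elim (metis ennreal_0 ennreal_eq_0_iff order_antisym)
    with A(1) show "A \<in> null_sets (density L f)"
      by (simp add: null_sets_density_iff[OF fm])
  qed
  have "AE \<omega> in M. 0 < f (Z \<omega>)"
    by (rule distributed_AE_pos[OF f])
  with pos have ae: "AE \<omega> in M. log b (f (Z \<omega>) / g (Z \<omega>)) = log b (f (Z \<omega>)) - log b (g (Z \<omega>))"
    by eventually_elim (use b_gt_1 in \<open>simp add: log_divide\<close>)
  have int: "integrable M (\<lambda>\<omega>. log b (f (Z \<omega>) / g (Z \<omega>)))"
    using ae intf intg by (subst integrable_cong_AE[OF _ _ ae]) auto
  have "KL_divergence b (density L g) (distr M L Z) = (\<integral>x. f x * log b (f x / g x) \<partial>L)"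
    unfolding D using ac nonneg b_gt_1 by (intro KL_density_density) auto
  also have "\<dots> = (\<integral>\<omega>. log b (f (Z \<omega>) / g (Z \<omega>)) \<partial>M)"
    by (intro distributed_integral[OF f(1)] f(2)) auto
  also have "\<dots> = (\<integral>\<omega>. log b (f (Z \<omega>)) - log b (g (Z \<omega>)) \<partial>M)"
    by (intro integral_cong_AE ae) auto
  also have "\<dots> = (\<integral>\<omega>. log b (f (Z \<omega>)) \<partial>M) - (\<integral>\<omega>. log b (g (Z \<omega>)) \<partial>M)"
    by (intro Bochner_Integration.integral_diff intf intg)
  also have "(\<integral>\<omega>. log b (f (Z \<omega>)) \<partial>M) = - entropy b L Z"
    using entropy_distr[OF f] distributed_integral[OF f(1) _ f(2), of "\<lambda>x. log b (f x)"] by simp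
  finally show eq: ?eq .
  assume "prob_space (density L g)"
  moreover have "prob_space (density L f)"
    unfolding D[symmetric] by (rule prob_space_distr[OF Z])
  moreover have "integrable L (\<lambda>x. f x * log b (f x / g x))"
    using int by (subst distributed_integrable[OF f(1) _ f(2)]) auto
  ultimately have "0 \<le> KL_divergence b (density L g) (density L f)"
    using ac nonneg b_gt_1 by (intro KL_density_density_nonneg) auto
  then show ?le using eq unfolding D by simp
qed


text \<open>Expectations over \<open>M\<close> replace integrals over \<open>L\<close>, so that log
  densities of blocks living on different product spaces can be added.\<close>

lemma finite_entropy_expectation:
  assumes "finite_entropy L Z f"
  shows integrable_log_finite_entropy: "integrable M (\<lambda>\<omega>. log b (f (Z \<omega>)))"
    and expectation_log_finite_entropy: "(\<integral>\<omega>. log b (f (Z \<omega>)) \<partial>M) = - entropy b L Z"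
proof -
  note D = finite_entropy_distributed[OF assms]
  note nn = finite_entropy_nn[OF assms]
  have m: "(\<lambda>x. log b (f x)) \<in> borel_measurable L"
    using finite_entropy_measurable[OF assms] by measurable
  show "integrable M (\<lambda>\<omega>. log b (f (Z \<omega>)))"
    using finite_entropy_integrable[OF assms] distributed_integrable[OF D m nn] by simp
  show "(\<integral>\<omega>. log b (f (Z \<omega>)) \<partial>M) = - entropy b L Z"
    using entropy_distr[OF D nn] distributed_integral[OF D m nn] by simp
qed

text \<open>Projection to coordinate 1 identifies the product over one index with \<open>R\<close>.
  The resulting density on \<open>R\<close> itself is what the product density over n coordinates is
  built from.\<close>

lemma finite_entropy_first_variable:
  fixes F :: "(nat \<Rightarrow> 'c) \<Rightarrow> real"
  assumes R: "sigma_finite_measure R"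
    and F: "finite_entropy (PiM {1..1} (\<lambda>_. R)) (\<lambda>\<omega>. \<lambda>i\<in>{1..1}. X i \<omega>) F"
  defines "f \<equiv> \<lambda>x. F (\<lambda>i\<in>{1..1}. x)"
  shows "distributed M R (X 1) f" "\<And>x. x \<in> space R \<Longrightarrow> 0 \<le> f x"
    "integrable M (\<lambda>\<omega>. log b (f (X 1 \<omega>)))"
    "(\<integral>\<omega>. log b (f (X 1 \<omega>)) \<partial>M) = - block_entropy R X 1"
proof -
  interpret R: sigma_finite_measure R by fact
  interpret R: product_sigma_finite "\<lambda>_. R" ..
  let ?P = "PiM {1::nat} (\<lambda>_. R)" and ?B = "\<lambda>\<omega>. \<lambda>i\<in>{1}. X i \<omega>"
  have F': "finite_entropy ?P ?B F"
    using F by simp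
  note D = finite_entropy_distributed[OF F']
  have [measurable]: "F \<in> borel_measurable ?P"
    by (rule finite_entropy_measurable[OF F'])
  have B[measurable]: "?B \<in> measurable M ?P" by (rule distributed_measurable[OF D])
  have c: "(\<lambda>x. x 1) \<in> measurable ?P R"
    by (intro measurable_component_singleton) simp
  have r: "(\<lambda>x. \<lambda>i\<in>{1::nat}. x) \<in> measurable R ?P"
    by (intro measurable_restrict) auto
  have f_eq: "f = (\<lambda>x. F (\<lambda>i\<in>{1}. x))"
    by (simp add: f_def)
  have f: "f \<in> borel_measurable R"
    unfolding f_eq by (intro measurable_compose[OF r]) measurable
  show "0 \<le> f x" if "x \<in> space R" for x
    unfolding f_eq using that by (intro finite_entropy_nn[OF F'] measurable_space[OF r])
  have X: "X 1 \<in> measurable M R"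
    using measurable_compose[OF B c] by simp
  have "distr M R (X 1) = distr (distr M ?P ?B) R (\<lambda>x. x 1)"
    using distr_distr[OF c B] by (simp add: comp_def)
  also have "\<dots> = distr (density ?P F) R (\<lambda>x. x 1)"
    by (simp only: distributed_distr_eq_density[OF D])
  also have "density ?P F = density ?P (\<lambda>x. f (x 1))"
  proof (intro density_cong)
    have "F x = f (x 1)" if "x \<in> space ?P" for x
    proof -
      have "(\<lambda>i\<in>{1}. x 1) = x"
        using that by (auto simp: space_PiM PiE_iff extensional_def fun_eq_iff)
      then show ?thesis by (simp add: f_eq)
    qed
    then show "AE x in ?P. ennreal (F x) = ennreal (f (x 1))" by (intro AE_I2) simp
  qed (use measurable_compose[OF c f] \<open>F \<in> borel_measurable ?P\<close> in auto)
  also have "distr (density ?P (\<lambda>x. f (x 1))) R (\<lambda>x. x 1) = density (distr ?P R (\<lambda>x. x 1)) f"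
    using f c by (intro density_distr[symmetric]) auto
  also have "distr ?P R (\<lambda>x. x 1) = R"
    by (rule R.distr_singleton)
  finally show "distributed M R (X 1) f"
    using X f by (simp add: distributed_def)
  have fX: "f (X 1 \<omega>) = F (?B \<omega>)" for \<omega>
    unfolding f_eq by (rule arg_cong[of _ _ F]) auto
  show "integrable M (\<lambda>\<omega>. log b (f (X 1 \<omega>)))"
    unfolding fX by (rule integrable_log_finite_entropy[OF F'])
  show "(\<integral>\<omega>. log b (f (X 1 \<omega>)) \<partial>M) = - block_entropy R X 1"
    unfolding fX expectation_log_finite_entropy[OF F'] by (simp add: block_entropy_def)
qed

section \<open>Total correlation, subadditivity and constant shifts\<close>

text \<open>With \<open>g\<close> the product of the marginal densities, \<open>P\<close> has
  density \<open>g\<close>, and the cross term of the divergence is a sum of n equal expectations,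
  each minus \<open>block_entropy R X 1\<close>. The first claim supplies the absolute continuity
  that transport of the divergence requires.\<close>

lemma total_correlation_block_entropy:
  fixes X :: "nat \<Rightarrow> 'a \<Rightarrow> 'c"
  assumes R: "sigma_finite_measure R"
    and FE: "\<And>k. k \<ge> 1 \<Longrightarrow> \<exists>f. finite_entropy (PiM {1..k} (\<lambda>_. R)) (\<lambda>\<omega>. \<lambda>i\<in>{1..k}. X i \<omega>) f"
    and X: "\<And>i. i \<ge> 1 \<Longrightarrow> X i \<in> measurable M R"
    and marg: "\<And>i. i \<ge> 1 \<Longrightarrow> distr M R (X i) = distr M R (X 1)"
    and n: "n \<ge> 1"
  defines "P \<equiv> PiM {1..n} (\<lambda>_. distr M R (X 1))"
    and "Q \<equiv> distr M (PiM {1..n} (\<lambda>_. R)) (\<lambda>\<omega>. \<lambda>i\<in>{1..n}. X i \<omega>)"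
  shows "absolutely_continuous P Q"
    and "KL_divergence b P Q = real n * block_entropy R X 1 - block_entropy R X n"
proof -
  interpret R: sigma_finite_measure R by fact
  interpret R: product_sigma_finite "\<lambda>_. R" ..
  interpret Rn: finite_product_sigma_finite "\<lambda>_. R" "{1..n}" by standard simp
  let ?L = "PiM {1..n} (\<lambda>_. R)" and ?Z = "\<lambda>\<omega>. \<lambda>i\<in>{1..n}. X i \<omega>"
  obtain F where F: "finite_entropy (PiM {1..1} (\<lambda>_. R)) (\<lambda>\<omega>. \<lambda>i\<in>{1..1}. X i \<omega>) F"
    using FE[of 1] by auto
  define f where "f x = F (\<lambda>i\<in>{1..1}. x)" for x
  note f1 = finite_entropy_first_variable[OF R F, folded f_def]
  note [measurable] = distributed_real_measurable[OF f1(2,1)]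
  have D: "distributed M R (X i) f" if "i \<ge> 1" for i
    using f1(1) X[OF that] marg[OF that] by (simp add: distributed_def)
  obtain fn where fn: "finite_entropy ?L ?Z fn" using FE[OF n] by auto
  define g where "g x = (\<Prod>i\<in>{1..n}. f (x i))" for x
  have gm: "g \<in> borel_measurable ?L" unfolding g_def by measurable
  have gnn: "0 \<le> g x" if "x \<in> space ?L" for x
    unfolding g_def using that by (intro prod_nonneg ballI f1(2)) (auto simp: space_PiM PiE_iff)
  have gZ: "g (?Z \<omega>) = (\<Prod>i\<in>{1..n}. f (X i \<omega>))" for \<omega>
    unfolding g_def by (intro prod.cong) auto
  have pos: "AE \<omega> in M. \<forall>i\<in>{1..n}. 0 < f (X i \<omega>)"
    by (intro AE_finite_allI distributed_AE_pos[OF D f1(2)]) auto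
  have gpos: "AE \<omega> in M. 0 < g (?Z \<omega>)"
    using pos unfolding gZ by eventually_elim (auto intro: prod_pos)
  have log_g: "AE \<omega> in M. (\<Sum>i\<in>{1..n}. log b (f (X i \<omega>))) = log b (g (?Z \<omega>))"
    using pos unfolding gZ
  proof eventually_elim
    case (elim \<omega>)
    then show ?case
      by (subst log_def, subst ln_prod) (force simp: log_def sum_divide_distrib)+
  qed
  have lm: "(\<lambda>x. log b (f x)) \<in> borel_measurable R" by measurable
  \<comment> \<open>Every \<open>X i\<close> has density \<open>f\<close>, so integrability and
    expectation of its log density are facts about \<open>f\<close> on \<open>R\<close> and carry
    over from i = 1.\<close>
  have int1: "integrable M (\<lambda>\<omega>. log b (f (X i \<omega>)))" 
    and E1: "(\<integral>\<omega>. log b (f (X i \<omega>)) \<partial>M) = - block_entropy R X 1" if "i \<ge> 1" for i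
    using distributed_integrable[OF D[OF that] lm f1(2)] distributed_integrable[OF f1(1) lm f1(2)]
      distributed_integral[OF D[OF that] lm f1(2)] distributed_integral[OF f1(1) lm f1(2)] f1(3,4)
    by auto
  have Zm: "?Z \<in> measurable M ?L"
    by (rule distributed_measurable[OF finite_entropy_distributed[OF fn]])
  have lgm: "(\<lambda>\<omega>. log b (g (?Z \<omega>))) \<in> borel_measurable M"
    by (intro borel_measurable_log borel_measurable_const measurable_compose[OF Zm gm])
  have ints: "integrable M (\<lambda>\<omega>. \<Sum>i\<in>{1..n}. log b (f (X i \<omega>)))"
    using int1 by (intro Bochner_Integration.integrable_sum) auto
  have intg: "integrable M (\<lambda>\<omega>. log b (g (?Z \<omega>)))"
    by (rule integrable_cong_AE_imp[OF ints lgm]) (use log_g in auto)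
  have "(\<integral>\<omega>. log b (g (?Z \<omega>)) \<partial>M) = (\<integral>\<omega>. (\<Sum>i\<in>{1..n}. log b (f (X i \<omega>))) \<partial>M)"
    using log_g ints lgm by (intro integral_cong_AE) auto
  also have "\<dots> = (\<Sum>i\<in>{1..n}. \<integral>\<omega>. log b (f (X i \<omega>)) \<partial>M)"
    using int1 by (intro Bochner_Integration.integral_sum) auto
  also have "\<dots> = - (real n * block_entropy R X 1)"
    using E1 by simp
  finally have Eg: "(\<integral>\<omega>. log b (g (?Z \<omega>)) \<partial>M) = - (real n * block_entropy R X 1)" .
  have dR: "distr M R (X 1) = density R f" by (rule distributed_distr_eq_density[OF f1(1)])
  have "prob_space (density R f)"
    unfolding dR[symmetric] by (rule prob_space_distr) (simp add: X)
  then have P: "P = density ?L g"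
    unfolding P_def dR g_def using R f1(2) by (intro PiM_density_power) auto
  note fn' = finite_entropy_distributed[OF fn] finite_entropy_nn[OF fn] gm gnn gpos
      integrable_log_finite_entropy[OF fn] intg
  show "absolutely_continuous P Q"
    unfolding P Q_def by (rule absolutely_continuous_density_distr
        [where L = ?L and Z = ?Z and f = fn and g = g, OF Rn.sigma_finite_measure_axioms fn'])
  have "KL_divergence b P Q = - entropy b ?L ?Z - (\<integral>\<omega>. log b (g (?Z \<omega>)) \<partial>M)"
    unfolding P Q_def by (rule KL_divergence_density_entropy
        [where L = ?L and Z = ?Z and f = fn and g = g, OF Rn.sigma_finite_measure_axioms fn'])
  then show "KL_divergence b P Q = real n * block_entropy R X 1 - block_entropy R X n"
    unfolding Eg using n by (simp add: block_entropy_def)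
qed

text \<open>Gibbs' inequality for the joint law against the product of the laws of the first m and
  the last n variables. Stationarity gives the last n variables the density and entropy of the first
  n.\<close>

lemma block_entropy_subadditive:
  fixes X :: "nat \<Rightarrow> 'a \<Rightarrow> 'c"
  assumes R: "sigma_finite_measure R"
    and FE: "\<And>k. k \<ge> 1 \<Longrightarrow> \<exists>f. finite_entropy (PiM {1..k} (\<lambda>_. R)) (\<lambda>\<omega>. \<lambda>i\<in>{1..k}. X i \<omega>) f"
    and X: "stationary_process M R X"
  shows "block_entropy R X (m + n) \<le> block_entropy R X m + block_entropy R X n"
\<comment> \<open>Length 0 is separate: its entropy is 0 by convention, and densities are supplied
  only for positive lengths.\<close>
proof (cases "m = 0 \<or> n = 0")
  case True
  then show ?thesis by (auto simp: block_entropy_def)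
next
  case False
  then have mn: "m \<ge> 1" "n \<ge> 1" by auto
  interpret R: sigma_finite_measure R by fact
  interpret R: product_sigma_finite "\<lambda>_. R" ..
  interpret L: finite_product_sigma_finite "\<lambda>_. R" "{1..m+n}" by standard simp
  let ?P = "\<lambda>k. PiM {1..k} (\<lambda>_. R)" and ?Z = "\<lambda>k \<omega>. \<lambda>i\<in>{1..k}. X i \<omega>"
  \<comment> \<open>The block from m+1 to m+n, indexed from 1 so that stationarity with shift m
    compares it with \<open>?Z n\<close>.\<close>
  let ?S = "\<lambda>\<omega>. \<lambda>j\<in>{1..n}. X (j + m) \<omega>"
  obtain fm where fm: "finite_entropy (?P m) (?Z m) fm" using FE mn by blast
  obtain fn where fn: "finite_entropy (?P n) (?Z n) fn" using FE mn by blast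
  obtain f where f: "finite_entropy (?P (m+n)) (?Z (m+n)) f" using FE[of "m+n"] mn by auto
  note [measurable] = finite_entropy_measurable[OF fm] finite_entropy_measurable[OF fn]
  have "distr M (?P n) ?S = distr M (?P n) (?Z n)"
    using X unfolding stationary_process_def by (auto simp: subset_iff)
  moreover have "?S \<in> measurable M (?P n)"
    using X unfolding stationary_process_def by (intro measurable_restrict) auto
  ultimately have DS: "distributed M (?P n) ?S fn"
    using finite_entropy_distributed[OF fn] by (simp add: distributed_def)
  have fS: "finite_entropy (?P n) ?S fn"
    using fn DS by (simp add: finite_entropy_def)
  have ES: "entropy b (?P n) ?S = entropy b (?P n) (?Z n)"
    using \<open>distr M (?P n) ?S = _\<close> by (simp add: entropy_def)
  define g where "g x = fm (restrict x {1..m}) * fn (\<lambda>j\<in>{1..n}. x (j + m))" for x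
  have r: "(\<lambda>x. restrict x {1..m}) \<in> measurable (?P (m+n)) (?P m)"
    by (intro measurable_restrict measurable_component_singleton) auto
  have s: "(\<lambda>x. \<lambda>j\<in>{1..n}. x (j + m)) \<in> measurable (?P (m+n)) (?P n)"
    by (intro measurable_restrict measurable_component_singleton) auto
  have gm: "g \<in> borel_measurable (?P (m+n))"
    unfolding g_def
    by (intro borel_measurable_times measurable_compose[OF r] measurable_compose[OF s]) measurable
  have gnn1: "0 \<le> fm (restrict x {1..m})" and gnn2: "0 \<le> fn (\<lambda>j\<in>{1..n}. x (j + m))"
    if "x \<in> space (?P (m+n))" for x
    using finite_entropy_nn[OF fm measurable_space[OF r that]]
      finite_entropy_nn[OF fn measurable_space[OF s that]] by auto
  then have gnn: "0 \<le> g x" if "x \<in> space (?P (m+n))" for x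
    using that by (simp add: g_def)
  have gZ: "g (?Z (m+n) \<omega>) = fm (?Z m \<omega>) * fn (?S \<omega>)" for \<omega>
  proof -
    have "restrict (?Z (m+n) \<omega>) {1..m} = ?Z m \<omega>" "(\<lambda>j\<in>{1..n}. ?Z (m+n) \<omega> (j + m)) = ?S \<omega>"
      by (auto simp: fun_eq_iff)
    then show ?thesis by (simp only: g_def)
  qed
  have pos: "AE \<omega> in M. 0 < fm (?Z m \<omega>)" "AE \<omega> in M. 0 < fn (?S \<omega>)"
    using distributed_AE_pos[OF finite_entropy_distributed[OF fm] finite_entropy_nn[OF fm]]
      distributed_AE_pos[OF DS finite_entropy_nn[OF fn]] by auto
  have gpos: "AE \<omega> in M. 0 < g (?Z (m+n) \<omega>)"
    using pos unfolding gZ by eventually_elim simp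
  have log_g: "AE \<omega> in M. log b (fm (?Z m \<omega>)) + log b (fn (?S \<omega>)) = log b (g (?Z (m+n) \<omega>))"
    using pos unfolding gZ by eventually_elim (simp add: log_mult)
  have lgm: "(\<lambda>\<omega>. log b (g (?Z (m+n) \<omega>))) \<in> borel_measurable M"
    by (intro borel_measurable_log borel_measurable_const measurable_compose[OF _ gm]
        distributed_measurable[OF finite_entropy_distributed[OF f]])
  have ints: "integrable M (\<lambda>\<omega>. log b (fm (?Z m \<omega>)) + log b (fn (?S \<omega>)))"
    by (intro Bochner_Integration.integrable_add integrable_log_finite_entropy[OF fm]
        integrable_log_finite_entropy[OF fS])
  have intg: "integrable M (\<lambda>\<omega>. log b (g (?Z (m+n) \<omega>)))"
    by (rule integrable_cong_AE_imp[OF ints lgm]) (use log_g in auto)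
  have "(\<integral>\<omega>. log b (g (?Z (m+n) \<omega>)) \<partial>M) = (\<integral>\<omega>. log b (fm (?Z m \<omega>)) + log b (fn (?S \<omega>)) \<partial>M)"
    using log_g ints lgm by (intro integral_cong_AE) auto
  also have "\<dots> = - entropy b (?P m) (?Z m) + - entropy b (?P n) (?Z n)"
    unfolding ES[symmetric]
    by (subst Bochner_Integration.integral_add[OF integrable_log_finite_entropy[OF fm] 
          integrable_log_finite_entropy[OF fS]])
       (simp only: expectation_log_finite_entropy[OF fm] expectation_log_finite_entropy[OF fS])
  finally have Eg: "(\<integral>\<omega>. log b (g (?Z (m+n) \<omega>)) \<partial>M) = 
    - entropy b (?P m) (?Z m) + - entropy b (?P n) (?Z n)" .
  have one: "(\<integral>\<^sup>+x. ennreal (h x) \<partial>?P k) = 1"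
    if h: "finite_entropy (?P k) Z h" for h k and Z :: "'a \<Rightarrow> nat \<Rightarrow> 'c"
    using distributed_nn_integral[OF finite_entropy_distributed[OF h], of "\<lambda>_. 1"] emeasure_space_1
    by simp
  \<comment> \<open>Gibbs' inequality needs \<open>g\<close> to be a probability density. Its two
    factors depend on disjoint groups of coordinates, so its integral is a product of two total
    masses, both one.\<close>
  have "(\<integral>\<^sup>+x. ennreal (g x) \<partial>?P (m+n)) =
    (\<integral>\<^sup>+x. ennreal (fm (restrict x {1..m})) * ennreal (fn (\<lambda>j\<in>{1..n}. x (j + m))) \<partial>?P (m+n))"
    unfolding g_def by (intro nn_integral_cong ennreal_mult gnn1 gnn2)
  also have "\<dots> = (\<integral>\<^sup>+x. ennreal (fm x) \<partial>?P m) * (\<integral>\<^sup>+x. ennreal (fn x) \<partial>?P n)"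
    by (rule nn_integral_PiM_concat[OF R]) measurable
  also have "\<dots> = 1" by (simp only: one[OF fm] one[OF fn]) simp
  finally have g1: "(\<integral>\<^sup>+x. ennreal (g x) \<partial>?P (m+n)) = 1" .
  have "emeasure (density (?P (m+n)) g) (space (?P (m+n)))
      = (\<integral>\<^sup>+x. ennreal (g x) * indicator (space (?P (m+n))) x \<partial>?P (m+n))"
    by (intro emeasure_density measurable_compose[OF gm] sets.top) measurable
  also have "\<dots> = (\<integral>\<^sup>+x. ennreal (g x) \<partial>?P (m+n))"
    by (intro nn_integral_cong) (simp only: indicator_simps mult_1_right)
  finally have one_density: "emeasure (density (?P (m+n)) g) (space (?P (m+n))) = 1"
    by (simp only: g1)
  have "prob_space (density (?P (m+n)) g)"
  proof
    show "emeasure (density (?P (m+n)) g) (space (density (?P (m+n)) g)) = 1"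
      by (simp only: space_density one_density)
  qed
  then have "entropy b (?P (m+n)) (?Z (m+n)) \<le> - (\<integral>\<omega>. log b (g (?Z (m+n) \<omega>)) \<partial>M)"
    by (intro gibbs_entropy_le[where L = "?P (m+n)" and Z = "?Z (m+n)" and f = f and g = g, OF L.sigma_finite_measure_axioms finite_entropy_distributed[OF f]
          finite_entropy_nn[OF f] gm gnn gpos integrable_log_finite_entropy[OF f] intg])
  then show ?thesis
    using mn unfolding Eg by (simp add: block_entropy_def)
qed


text \<open>
  \<open>T'\<close> is only a left inverse, so \<open>S\<close> may be a proper measurable subspace of the space of \<open>R\<close>.
  The lemma is applied both to the transformation and to the inclusion of the state space, which
  compares the two block entropies through a divergence on \<open>S\<close>.
\<close>

lemma total_correlation_distr:
  fixes X :: "nat \<Rightarrow> 'a \<Rightarrow> 's" and T :: "'s \<Rightarrow> 'c"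
  assumes R: "sigma_finite_measure R"
    and T: "T \<in> measurable S R" and T': "T' \<in> measurable R S"
    and inv: "\<And>s. s \<in> space S \<Longrightarrow> T' (T s) = s"
    and X: "\<And>i. i \<ge> 1 \<Longrightarrow> X i \<in> measurable M S"
    and marg: "\<And>i. i \<ge> 1 \<Longrightarrow> distr M S (X i) = distr M S (X 1)"
    and FE: "\<And>k. k \<ge> 1 \<Longrightarrow>
      \<exists>f. finite_entropy (PiM {1..k} (\<lambda>_. R)) (\<lambda>\<omega>. \<lambda>i\<in>{1..k}. T (X i \<omega>)) f"
    and n: "n \<ge> 1"
  shows "KL_divergence b (PiM {1..n} (\<lambda>_. distr M S (X 1)))
      (distr M (PiM {1..n} (\<lambda>_. S)) (\<lambda>\<omega>. \<lambda>i\<in>{1..n}. X i \<omega>)) =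
    real n * block_entropy R (\<lambda>i \<omega>. T (X i \<omega>)) 1 - block_entropy R (\<lambda>i \<omega>. T (X i \<omega>)) n"
proof -
  let ?Y = "\<lambda>i \<omega>. T (X i \<omega>)"
  let ?D = "distr M S (X 1)" and ?D' = "distr M R (?Y 1)"
  let ?P = "PiM {1..n} (\<lambda>_. ?D)" and ?P' = "PiM {1..n} (\<lambda>_. ?D')" and ?R = "PiM {1..n} (\<lambda>_. R)"
  let ?Q = "distr M (PiM {1..n} (\<lambda>_. S)) (\<lambda>\<omega>. \<lambda>i\<in>{1..n}. X i \<omega>)"
  let ?Q' = "distr M ?R (\<lambda>\<omega>. \<lambda>i\<in>{1..n}. ?Y i \<omega>)"
  let ?t = "compose {1..n} T" and ?t' = "compose {1..n} T'"
  have Y: "?Y i \<in> measurable M R" if "i \<ge> 1" for i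
    by (rule measurable_compose[OF X[OF that] T])
  have D_T: "distr ?D R T = ?D'"
    using distr_distr[OF T X[of 1]] by (simp add: comp_def)
  have marg': "distr M R (?Y i) = ?D'" if "i \<ge> 1" for i
  proof -
    have "distr M R (?Y i) = distr (distr M S (X i)) R T"
      using distr_distr[OF T X[OF that]] by (simp add: comp_def)
    then show ?thesis by (simp only: marg[OF that] D_T)
  qed
  have PD: "prob_space ?D" "prob_space ?D'"
    using X[of 1] Y[of 1] by (auto intro!: prob_space_distr)
  have setsP: "sets ?P = sets (PiM {1..n} (\<lambda>_. S))" and setsP': "sets ?P' = sets ?R"
    by (auto intro!: sets_PiM_cong)
  \<comment> \<open>The coordinatewise map carries the product of the marginals to the product of
    their images, so both arguments of the divergence are transported by the same
    \<open>?t\<close>.\<close>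
  have "distr ?P ?R ?t = distr ?P ?P' ?t"
    by (rule distr_cong) (use setsP' in simp_all)
  also have "\<dots> = PiM {1..n} (\<lambda>_. distr ?D ?D' T)"
    using PD T by (intro distr_PiM_finite_prob_space') auto
  also have "distr ?D ?D' T = ?D'"
    unfolding D_T[symmetric] by (rule distr_cong) auto
  finally have P_t: "distr ?P ?R ?t = ?P'" .
  have t: "?t \<in> measurable ?P ?R"
    unfolding compose_def using T
    by (intro measurable_restrict measurable_compose[OF measurable_component_singleton]) auto
  have t': "?t' \<in> measurable ?R ?P"
    unfolding compose_def using T'
    by (intro measurable_restrict measurable_compose[OF measurable_component_singleton]) auto
  have tS: "?t \<in> measurable (PiM {1..n} (\<lambda>_. S)) ?R"
    using t by (simp only: measurable_cong_sets[OF setsP refl])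
  have B: "(\<lambda>\<omega>. \<lambda>i\<in>{1..n}. X i \<omega>) \<in> measurable M (PiM {1..n} (\<lambda>_. S))"
    using X by (intro measurable_restrict) auto
  have Q_t: "distr ?Q ?R ?t = ?Q'"
    unfolding distr_distr[OF tS B]
    by (intro distr_cong) (auto simp: compose_def fun_eq_iff)
  have inv_t: "?t' (?t x) = x" if "x \<in> space ?P" for x
    using that inv by (auto simp: compose_def space_PiM PiE_iff extensional_def fun_eq_iff)
  have "KL_divergence b ?P' ?Q' = KL_divergence b ?P ?Q"
    unfolding P_t[symmetric] Q_t[symmetric]
  proof (rule KL_divergence_distr)
    show "?t \<in> measurable ?P ?R" "?t' \<in> measurable ?R ?P" by (fact t t')+
    show "?t' (?t x) = x" if "x \<in> space ?P" for x by (fact inv_t[OF that])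
    have "prob_space ?P" by (intro prob_space_PiM PD)
    then show "sigma_finite_measure ?P"
      by (simp add: prob_space_imp_sigma_finite)
    \<comment> \<open>Densities are given only for the transformed variables, so absolute continuity
      is established on the image side.\<close>
    show "absolutely_continuous (distr ?P ?R ?t) (distr ?Q ?R ?t)"
      unfolding P_t Q_t by (rule total_correlation_block_entropy(1)[OF R FE Y marg' n])
    show "sets ?Q = sets ?P" by (simp only: sets_distr setsP)
  qed
  then show ?thesis
    using total_correlation_block_entropy(2)[OF R FE Y marg' n] by simp
qed

text \<open>
  Convergence cannot be dropped: without a limit, \<open>lim\<close> is an arbitrary value that need not
  move with the shift.
\<close>

lemma excess_entropy_eqI:
  assumes conv: "convergent (\<lambda>n. ereal (block_entropy R X n / real n))"
    and shift: "\<And>n. block_entropy R' Y n = block_entropy R X n + real n * c"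
  shows "excess_entropy R' Y = excess_entropy R X"
proof -
  from conv obtain L where L: "(\<lambda>n. ereal (block_entropy R X n / real n)) \<longlonglongrightarrow> L"
    by (auto simp: convergent_def)
  have "(\<lambda>n. ereal (block_entropy R X n / real n) + ereal c) \<longlonglongrightarrow> L + ereal c"
    by (intro tendsto_add_left_ereal L) simp
  \<comment> \<open>At n = 0 both quotients are 0 by the convention for division, so the shift by
    \<open>c\<close> appears only for n > 0.\<close>
  moreover have "\<forall>\<^sub>F n in sequentially. ereal (block_entropy R X n / real n) + ereal c
      = ereal (block_entropy R' Y n / real n)"
    using eventually_gt_at_top[of 0] by eventually_elim (simp add: shift field_simps)
  ultimately have "(\<lambda>n. ereal (block_entropy R' Y n / real n)) \<longlonglongrightarrow> L + ereal c"
    by (rule Lim_transform_eventually)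
  then have rates: "entropy_rate R X = L" "entropy_rate R' Y = L + ereal c"
    using L by (simp_all add: entropy_rate_def limI)
  have "entropy_gain R' Y (Suc n) = entropy_gain R X (Suc n) + c" for n
    by (simp add: entropy_gain_def shift algebra_simps)
  \<comment> \<open>For finite \<open>L\<close> the constant cancels; an infinite \<open>L\<close>
    absorbs it, and both differences are the same infinity.\<close>
  then have "ereal (entropy_gain R' Y (Suc n)) - entropy_rate R' Y
      = ereal (entropy_gain R X (Suc n)) - entropy_rate R X" for n
    unfolding rates by (cases L) auto
  then show ?thesis by (simp add: excess_entropy_def)
qed

end

section \<open>Stationarity under maps and extension of maps\<close>

text \<open>The shifted and unshifted block laws of the image process are images of those of
  \<open>X\<close> under one coordinatewise map. Applied to the inclusion of a Borel set, this makes
  a process with values there stationary in the ambient space.\<close>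

lemma stationary_process_compose:
  assumes X: "stationary_process M S X" and T: "T \<in> measurable S R"
  shows "stationary_process M R (\<lambda>i \<omega>. T (X i \<omega>))"
  unfolding stationary_process_def
proof (intro conjI allI impI)
  have Xm: "X i \<in> measurable M S" if "i \<ge> 1" for i
    using X that by (simp add: stationary_process_def)
  show "(\<lambda>\<omega>. T (X i \<omega>)) \<in> measurable M R" if "1 \<le> i" for i
    by (rule measurable_compose[OF Xm[OF that] T])
  fix J :: "nat set" and k assume J: "finite J \<and> J \<subseteq> {1..}"
  have t: "compose J T \<in> measurable (PiM J (\<lambda>_. S)) (PiM J (\<lambda>_. R))"
    unfolding compose_def using T
    by (intro measurable_restrict measurable_compose[OF measurable_component_singleton]) auto
  have shift: "distr M (PiM J (\<lambda>_. R)) (\<lambda>\<omega>. \<lambda>j\<in>J. T (X (j + l) \<omega>)) =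
    distr (distr M (PiM J (\<lambda>_. S)) (\<lambda>\<omega>. \<lambda>j\<in>J. X (j + l) \<omega>)) (PiM J (\<lambda>_. R)) (compose J T)" for l
  proof -
    have "(\<lambda>\<omega>. \<lambda>j\<in>J. X (j + l) \<omega>) \<in> measurable M (PiM J (\<lambda>_. S))"
      using J by (intro measurable_restrict Xm) auto
    from distr_distr[OF t this] show ?thesis
      by (auto simp: compose_def comp_def fun_eq_iff intro!: distr_cong)
  qed
  have "distr M (PiM J (\<lambda>_. S)) (\<lambda>\<omega>. \<lambda>j\<in>J. X (j + k) \<omega>) = distr M (PiM J (\<lambda>_. S)) (\<lambda>\<omega>. \<lambda>j\<in>J. X (j + 0) \<omega>)"
    using X J unfolding stationary_process_def by auto
  then show "distr M (PiM J (\<lambda>_. R)) (\<lambda>\<omega>. \<lambda>j\<in>J. T (X (j + k) \<omega>)) =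
      distr M (PiM J (\<lambda>_. R)) (\<lambda>\<omega>. \<lambda>j\<in>J. T (X j \<omega>))"
    using shift[of k] shift[of 0] by simp
qed

text \<open>Stationarity for \<open>J = {1}\<close> with shift \<open>i - 1\<close>, followed by
  projection from the one-index product.\<close>

lemma stationary_process_marginal:
  assumes X: "stationary_process M S X" and i: "i \<ge> 1"
  shows "distr M S (X i) = distr M S (X 1)"
proof -
  have c: "(\<lambda>x. x 1) \<in> measurable (PiM {1::nat} (\<lambda>_. S)) S"
    by (intro measurable_component_singleton) simp
  have *: "distr M S (X (1 + l)) =
    distr (distr M (PiM {1::nat} (\<lambda>_. S)) (\<lambda>\<omega>. \<lambda>j\<in>{1}. X (j + l) \<omega>)) S (\<lambda>x. x 1)" for l
  proof -
    have "(\<lambda>\<omega>. \<lambda>j\<in>{1}. X (j + l) \<omega>) \<in> measurable M (PiM {1::nat} (\<lambda>_. S))"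
      using X by (intro measurable_restrict) (auto simp: stationary_process_def)
    from distr_distr[OF c this] show ?thesis by (simp add: comp_def)
  qed
  have "distr M (PiM {1::nat} (\<lambda>_. S)) (\<lambda>\<omega>. \<lambda>j\<in>{1}. X (j + (i - 1)) \<omega>) =
    distr M (PiM {1::nat} (\<lambda>_. S)) (\<lambda>\<omega>. \<lambda>j\<in>{1}. X (j + 0) \<omega>)"
    using X unfolding stationary_process_def by simp
  then show ?thesis
    using *[of "i - 1"] *[of 0] i by simp
qed

text \<open>Turns an inverse defined only on a state space into a measurable left inverse on the
  ambient space; any point of the target serves as the value off \<open>A\<close>.\<close>

lemma measurable_extend_constant:
  assumes A: "A \<in> sets M" and f: "f \<in> measurable (restrict_space M A) N" and c: "c \<in> space N"
  shows "(\<lambda>x. if x \<in> A then f x else c) \<in> measurable M N"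
  using measurable_restrict_space_iff[of A M c N f] assms by auto

section \<open>The discrete and the continuous case\<close>

context information_space
begin

text \<open>Entropy is minus the divergence relative to counting measure, and the coordinatewise
  bijection carries counting measure on blocks to counting measure. Comparing the integrals as they
  stand also covers divergent sums, where the Bochner integral takes its default value.\<close>

lemma block_entropy_discrete_invariant:
  assumes S: "countable S" and X: "stationary_process M (count_space S) X"
    and T: "invertible_transformation (count_space S) (count_space S') T"
  shows "block_entropy (count_space S') (\<lambda>i \<omega>. T (X i \<omega>)) n = block_entropy (count_space S) X n"
proof (cases "n = 0")
  case True
  then show ?thesis by (simp add: block_entropy_def)
next
  case False
  have bij: "bij_betw T S S'"
    using T by (simp add: invertible_transformation_def)
  then have S': "countable S'"
    using S by (metis bij_betw_imp_surj_on countable_image)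
  let ?C = "PiE {1..n} (\<lambda>_. S)" and ?C' = "PiE {1..n} (\<lambda>_. S')"
  let ?t = "compose {1..n} T" and ?t' = "compose {1..n} (the_inv_into S T)"
  let ?B = "\<lambda>\<omega>. \<lambda>i\<in>{1..n}. X i \<omega>" and ?B' = "\<lambda>\<omega>. \<lambda>i\<in>{1..n}. T (X i \<omega>)"
  have P: "PiM {1..n} (\<lambda>_. count_space S) = count_space ?C"
    "PiM {1..n} (\<lambda>_. count_space S') = count_space ?C'"
    using S S' by (intro count_space_PiM_finite; simp)+
  have inv: "?t' (?t x) = x" if "x \<in> ?C" for x
    using that bij
    by (auto simp: compose_def fun_eq_iff PiE_iff extensional_def bij_betw_def the_inv_into_f_f)
  have inv': "?t (?t' x) = x" if "x \<in> ?C'" for x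
    using that bij
    by (auto simp: compose_def fun_eq_iff PiE_iff extensional_def f_the_inv_into_f_bij_betw)
  have img: "?t x \<in> ?C'" if "x \<in> ?C" for x
    using that bij by (auto simp: compose_def PiE_iff bij_betw_def)
  have img': "?t' x \<in> ?C" if "x \<in> ?C'" for x
    using that bij_betw_the_inv_into[OF bij] by (auto simp: compose_def PiE_iff bij_betw_def)
  have bij_t: "bij_betw ?t ?C ?C'"
    by (intro bij_betw_byWitness[where f' = ?t'] ballI image_subsetI inv inv' img img')
  have t: "?t \<in> measurable (count_space ?C) (count_space ?C')"
    unfolding measurable_count_space_eq1 space_count_space by (intro Pi_I img)
  have t': "?t' \<in> measurable (count_space ?C') (count_space ?C)"
    unfolding measurable_count_space_eq1 space_count_space by (intro Pi_I img')
  have "?B \<in> measurable M (PiM {1..n} (\<lambda>_. count_space S))"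
    using X by (intro measurable_restrict) (auto simp: stationary_process_def)
  then have B: "?B \<in> measurable M (count_space ?C)" by (simp only: P)
  have L: "distr (count_space ?C) (count_space ?C') ?t = count_space ?C'"
    by (rule distr_bij_count_space[OF bij_t])
  have "distr (distr M (count_space ?C) ?B) (count_space ?C') ?t = distr M (count_space ?C') ?B'"
    unfolding distr_distr[OF t B] by (intro distr_cong) (auto simp: compose_def fun_eq_iff)
  moreover have "KL_divergence b (distr (count_space ?C) (count_space ?C') ?t)
      (distr (distr M (count_space ?C) ?B) (count_space ?C') ?t)
    = KL_divergence b (count_space ?C) (distr M (count_space ?C) ?B)"
  proof (rule KL_divergence_distr)
    show "?t \<in> measurable (count_space ?C) (count_space ?C')"
      "?t' \<in> measurable (count_space ?C') (count_space ?C)" by (fact t t')+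
    show "sigma_finite_measure (count_space ?C)"
      using S by (intro sigma_finite_measure_count_space_countable countable_PiE) auto
    \<comment> \<open>Counting measure has no nonempty null set, so absolute continuity with respect
      to it is automatic.\<close>
    show "absolutely_continuous (distr (count_space ?C) (count_space ?C') ?t)
        (distr (distr M (count_space ?C) ?B) (count_space ?C') ?t)"
      unfolding L by (simp add: absolutely_continuous_def null_sets_count_space)
  qed (use inv in auto)
  ultimately have "entropy b (count_space ?C') ?B' = entropy b (count_space ?C) ?B"
    by (simp only: entropy_def L)
  then show ?thesis using False P by (simp add: block_entropy_def)
qed

lemma excess_entropy_continuous_invariant:
  fixes X :: "nat \<Rightarrow> 'a \<Rightarrow> 'c::euclidean_space" and T :: "'c \<Rightarrow> 'd::euclidean_space"
  assumes A: "A \<in> sets borel" and B: "B \<in> sets borel"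
    and X: "stationary_process M (restrict_space borel A) X"
    and T: "invertible_transformation (restrict_space borel A) (restrict_space borel B) T"
    and cX: "continuous_process X" and cY: "continuous_process (\<lambda>i \<omega>. T (X i \<omega>))"
  shows "excess_entropy lborel (\<lambda>i \<omega>. T (X i \<omega>)) = excess_entropy lborel X"
proof -
  let ?S = "restrict_space borel A" and ?Y = "\<lambda>i \<omega>. T (X i \<omega>)"
  let ?H = "block_entropy lborel X" and ?H' = "block_entropy lborel ?Y"
  have spS: "space ?S = A" by (simp add: space_restrict_space)
  have Xm: "X i \<in> measurable M ?S" if "i \<ge> 1" for i
    using X that by (simp add: stationary_process_def)
  note marg = stationary_process_marginal[OF X]
  \<comment> \<open>The sample space of a probability measure is nonempty, so \<open>X 1\<close>
    takes some value in \<open>A\<close>. It is the default value of the left inverses outside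
    \<open>A\<close> and \<open>B\<close>.\<close>
  obtain a where a: "a \<in> A"
    using not_empty measurable_space[OF Xm[of 1]] spS by auto
  have incl: "(\<lambda>x. x) \<in> measurable ?S lborel"
    by (simp add: measurable_restrict_space1)
  have retr: "(\<lambda>x. if x \<in> A then x else a) \<in> measurable lborel ?S"
    using measurable_extend_constant[of A borel "\<lambda>x. x" ?S a] A a spS by simp
  have bij: "bij_betw T A B" and Tm: "T \<in> measurable ?S (restrict_space borel B)"
    and T'm: "the_inv_into A T \<in> measurable (restrict_space borel B) ?S"
    using T by (simp_all add: invertible_transformation_def space_restrict_space)
  have T1: "T \<in> measurable ?S lborel"
    using Tm by (simp add: measurable_restrict_space2_iff)
  have T2: "(\<lambda>x. if x \<in> B then the_inv_into A T x else a) \<in> measurable lborel ?S"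
    using measurable_extend_constant[OF B T'm, of a] a spS by simp
  have inv: "(if T s \<in> B then the_inv_into A T (T s) else a) = s" if "s \<in> space ?S" for s
    using that bij spS by (auto simp: bij_betw_def the_inv_into_f_f)
  have FX: "\<exists>f. finite_entropy (PiM {1..k} (\<lambda>_. lborel)) (\<lambda>\<omega>. \<lambda>i\<in>{1..k}. X i \<omega>) f" if "k \<ge> 1" for k
    using cX that by (simp add: continuous_process_def)
  have FY: "\<exists>f. finite_entropy (PiM {1..k} (\<lambda>_. lborel)) (\<lambda>\<omega>. \<lambda>i\<in>{1..k}. T (X i \<omega>)) f" if "k \<ge> 1" for k
    using cY that by (simp add: continuous_process_def)
  \<comment> \<open>Equating the total correlations seen through the inclusion and through
    \<open>T\<close> leaves the constant \<open>?H' 1 - ?H 1\<close> per variable.\<close>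
  have "?H' n = ?H n + real n * (?H' 1 - ?H 1)" for n
  proof (cases "n = 0")
    case True
    then show ?thesis by (simp add: block_entropy_def)
  next
    case False
    then have n: "n \<ge> 1" by simp
    have "real n * ?H 1 - ?H n = real n * ?H' 1 - ?H' n"
      using total_correlation_distr[OF lborel.sigma_finite_measure_axioms incl retr _ Xm marg FX n]
        total_correlation_distr[OF lborel.sigma_finite_measure_axioms T1 T2 inv Xm marg FY n]
      by (simp add: spS)
    then show ?thesis by (simp add: algebra_simps)
  qed
  \<comment> \<open>Entropies are taken relative to \<open>lborel\<close>, so subadditivity is
    applied to \<open>X\<close> as a stationary process in the whole space.\<close>
  moreover have "convergent (\<lambda>n. ereal (?H n / real n))"
    using block_entropy_subadditive[OF lborel.sigma_finite_measure_axioms FX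
        stationary_process_compose[OF X incl]]
    by (intro convergent_subadditive_div) (auto simp: block_entropy_def)
  ultimately show ?thesis by (intro excess_entropy_eqI)
qed

end


theorem theorem2p4:
  fixes M :: "'o measure" and b :: real
  assumes "information_space M b"
  shows
    "(\<forall>(S :: 'a set) (S' :: 'b set) (X :: nat \<Rightarrow> 'o \<Rightarrow> 'a) (T :: 'a \<Rightarrow> 'b).
        countable S \<and>
        stationary_process M (count_space S) X \<and>
        invertible_transformation (count_space S) (count_space S') T \<longrightarrow>
        information_space.excess_entropy M b (count_space S') (\<lambda>i \<omega>. T (X i \<omega>)) =
        information_space.excess_entropy M b (count_space S) X) \<and>
     (\<forall>(A :: 'c::euclidean_space set) (B :: 'd::euclidean_space set)
        (X :: nat \<Rightarrow> 'o \<Rightarrow> 'c) (T :: 'c \<Rightarrow> 'd).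
        A \<in> sets borel \<and> B \<in> sets borel \<and>
        stationary_process M (restrict_space borel A) X \<and>
        invertible_transformation (restrict_space borel A) (restrict_space borel B) T \<and>
        information_space.continuous_process M b X \<and>
        information_space.continuous_process M b (\<lambda>i \<omega>. T (X i \<omega>)) \<longrightarrow>
        information_space.excess_entropy M b lborel (\<lambda>i \<omega>. T (X i \<omega>)) =
        information_space.excess_entropy M b lborel X)"
proof -
  interpret information_space M b by fact
  show ?thesis
  proof (intro conjI allI impI)
    fix S :: "'a set" and S' :: "'b set" and X :: "nat \<Rightarrow> 'o \<Rightarrow> 'a" and T :: "'a \<Rightarrow> 'b"
    assume "countable S \<and> stationary_process M (count_space S) X \<and>
      invertible_transformation (count_space S) (count_space S') T"
    \<comment> \<open>Block entropies agree at every length, so the gains and the \<open>lim\<close>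
      in the rate agree as expressions.\<close>
    then have "block_entropy (count_space S') (\<lambda>i \<omega>. T (X i \<omega>)) n = block_entropy (count_space S) X n" for n
      by (intro block_entropy_discrete_invariant) auto
    then show "excess_entropy (count_space S') (\<lambda>i \<omega>. T (X i \<omega>)) = excess_entropy (count_space S) X"
      by (simp add: excess_entropy_def entropy_gain_def entropy_rate_def)
  next
    fix A :: "'c set" and B :: "'d set" and X :: "nat \<Rightarrow> 'o \<Rightarrow> 'c" and T :: "'c \<Rightarrow> 'd"
    assume "A \<in> sets borel \<and> B \<in> sets borel \<and> stationary_process M (restrict_space borel A) X \<and>
      invertible_transformation (restrict_space borel A) (restrict_space borel B) T \<and>
      continuous_process X \<and> continuous_process (\<lambda>i \<omega>. T (X i \<omega>))"
    then show "excess_entropy lborel (\<lambda>i \<omega>. T (X i \<omega>)) = excess_entropy lborel X"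
      by (intro excess_entropy_continuous_invariant) auto
  qed
qed

end
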